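(* Let $f:\mathbb{R}^k\to\mathbb{R}$ be a $C^1$ function and fix a constant $0<\alpha<1$. Let $\{x_n\}_{n\ge 0}$ be a sequence in $\mathbb{R}^k$ and $\{\delta_n\}_{n\ge 0}$ a sequence of positive numbers such that for every $n$, $x_{n+1}=x_n-\delta_n\nabla f(x_n)$ and Armijo's condition $f(x_n-\delta_n\nabla f(x_n))-f(x_n)\le -\alpha\delta_n\|\nabla f(x_n)\|^2$ holds. Assume that $\nabla f(x_n)\neq 0$ for all $n$, and that $\{x_n\}$ converges to a point $x_\infty$ which is a non-degenerate critical point of $f$, i.e. $\nabla f(x_\infty)=0$, $f$ is $C^2$ in a neighbourhood of $x_\infty$, and the Hessian $\nabla^2 f(x_\infty)$ is invertible. Then for every $\epsilon>0$ there exists $n_\epsilon$ such that for all $n\ge n_\epsilon$, $$\alpha\delta_n\le \frac12\left(\|\nabla^2 f(x_\infty)\|+\epsilon\right)\left(\|\nabla^2 f(x_\infty)^{-1}\|+\epsilon\right)^2.$$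
   Context: $\|\cdot\|$ denotes the Euclidean norm on vectors and the corresponding operator norm on matrices. *)

theory Defs
  imports "HOL-Analysis.Analysis"
begin

end

theory Submission
  imports Defs
begin

text \<open>
  Near the non-degenerate critical point \<open>x\<^sub>\<infinity>\<close> with Hessian \<open>H\<close>, the gradient is
  comparable to the displacement: \<open>\<parallel>\<nabla>f(w)\<parallel> \<le> (\<parallel>H\<parallel> + \<epsilon>) \<parallel>w - x\<^sub>\<infinity>\<parallel>\<close> and
  \<open>\<parallel>w - x\<^sub>\<infinity>\<parallel> \<le> (\<parallel>H\<inverse>\<parallel> + \<epsilon>) \<parallel>\<nabla>f(w)\<parallel>\<close>. Integrating the first bound along the segment
  gives \<open>f(w) - f(x\<^sub>\<infinity>) \<le> (\<parallel>H\<parallel> + \<epsilon>)/2 \<parallel>w - x\<^sub>\<infinity>\<parallel>\<^sup>2\<close>. The Armijo steps make \<open>f(x\<^sub>n)\<close>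
  decrease to \<open>f(x\<^sub>\<infinity>)\<close>, so one step's decrease \<open>\<alpha>\<delta>\<^sub>n\<parallel>\<nabla>f(x\<^sub>n)\<parallel>\<^sup>2\<close> is at most
  \<open>f(x\<^sub>n) - f(x\<^sub>\<infinity>)\<close>. Chaining the three bounds and cancelling \<open>\<parallel>\<nabla>f(x\<^sub>n)\<parallel>\<^sup>2 > 0\<close>
  bounds \<open>\<alpha>\<delta>\<^sub>n\<close>.
\<close>

lemma matrix_inv_left:
  fixes A :: "'a::semiring_1^'n^'m"
  assumes "invertible A"
  shows "matrix_inv A ** A = mat 1"
  using someI_ex[OF assms[unfolded invertible_def]] unfolding matrix_inv_def by blast

lemma matrix_inv_mult_vec_cancel:
  fixes A :: "'a::comm_semiring_1^'n^'m"
  assumes "invertible A"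
  shows "matrix_inv A *v (A *v v) = v"
  by (simp add: matrix_vector_mul_assoc matrix_inv_left[OF assms])

lemma eventually_has_derivative_at_error:
  assumes "(g has_derivative L) (at a)" and "0 < e"
  shows "\<forall>\<^sub>F y in nhds a. norm (g y - g a - L (y - a)) \<le> e * norm (y - a)"
  using assms unfolding has_derivative_at_alt eventually_nhds_metric dist_norm by blast

lemma eventually_norm_le_onorm_derivative:
  fixes g :: "'a::real_normed_vector \<Rightarrow> 'b::real_normed_vector"
  assumes g: "(g has_derivative L) (at a)" and "g a = 0" and "0 < e"
  shows "\<forall>\<^sub>F y in nhds a. norm (g y) \<le> (onorm L + e) * norm (y - a)"
  using eventually_has_derivative_at_error[OF g \<open>0 < e\<close>]
proof eventually_elim
  case (elim y)
  have "norm (g y) \<le> norm (L (y - a)) + norm (g y - L (y - a))"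
    using norm_triangle_ineq[of "L (y - a)" "g y - L (y - a)"] by simp
  also have "\<dots> \<le> onorm L * norm (y - a) + e * norm (y - a)"
    using onorm[OF has_derivative_bounded_linear[OF g]] elim \<open>g a = 0\<close> by (intro add_mono) auto
  finally show ?case by (simp add: distrib_right)
qed

lemma le_of_le_mult_plus_small:
  fixes B e \<eta> G r :: real
  assumes r: "r \<le> B * (G + \<eta> * r)" and \<eta>: "(B + e) * B * \<eta> \<le> e"
    and "0 \<le> B" "0 < e" "0 \<le> G" "0 \<le> r"
  shows "r \<le> (B + e) * G"
proof -
  have "(B + e) * r \<le> (B + e) * B * G + (B + e) * B * \<eta> * r"
    using mult_left_mono[OF r, of "B + e"] assms by (simp add: algebra_simps)
  also have "\<dots> \<le> (B + e) * B * G + e * r"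
    using \<eta> \<open>0 \<le> r\<close> by (simp add: mult_right_mono)
  finally have "B * r \<le> B * ((B + e) * G)" by (simp add: algebra_simps)
  then show ?thesis
    using r \<open>0 \<le> B\<close> \<open>0 < e\<close> \<open>0 \<le> G\<close>
    by (cases "B = 0") (auto intro: order_trans[OF _ mult_nonneg_nonneg])
qed

lemma eventually_norm_le_onorm_inverse_derivative:
  fixes g :: "'a::real_normed_vector \<Rightarrow> 'b::real_normed_vector"
  assumes g: "(g has_derivative L) (at a)" and "g a = 0" and "0 < e"
    and M: "bounded_linear M" and left_inverse: "\<And>v. M (L v) = v"
  shows "\<forall>\<^sub>F y in nhds a. norm (y - a) \<le> (onorm M + e) * norm (g y)"
proof -
  define B where "B = onorm M"
  have "0 \<le> B" unfolding B_def using onorm_pos_le[OF M] .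
  \<comment> \<open>Small enough that the linearization error \<open>\<eta> \<parallel>y - a\<parallel>\<close> costs at most \<open>e\<close> in the constant.\<close>
  define \<eta> where "\<eta> = e / (B + e)\<^sup>2"
  have "0 < \<eta>" unfolding \<eta>_def using \<open>0 \<le> B\<close> \<open>0 < e\<close> by simp
  have "(B + e) * B * \<eta> = e * (B / (B + e))"
    unfolding \<eta>_def using \<open>0 \<le> B\<close> \<open>0 < e\<close> by (simp add: power2_eq_square)
  also have "\<dots> \<le> e" using \<open>0 \<le> B\<close> \<open>0 < e\<close> by (intro mult_left_le) auto
  finally have \<eta>_small: "(B + e) * B * \<eta> \<le> e" .
  show ?thesis
    using eventually_has_derivative_at_error[OF g \<open>0 < \<eta>\<close>]
  proof eventually_elim
    case (elim y)
    have "norm (y - a) = norm (M (g y - (g y - L (y - a))))" by (simp add: left_inverse)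
    also have "\<dots> \<le> B * norm (g y - (g y - L (y - a)))" unfolding B_def by (rule onorm[OF M])
    also have "\<dots> \<le> B * (norm (g y) + \<eta> * norm (y - a))"
      using norm_triangle_ineq4[of "g y" "g y - L (y - a)"] elim \<open>g a = 0\<close> \<open>0 \<le> B\<close>
      by (intro mult_left_mono) auto
    finally show ?case
      unfolding B_def[symmetric] using \<eta>_small \<open>0 \<le> B\<close> \<open>0 < e\<close>
      by (intro le_of_le_mult_plus_small) auto
  qed
qed

lemma le_quadratic_of_gradient_bound:
  fixes f :: "'a::real_inner \<Rightarrow> real"
  assumes grad: "\<And>y. (f has_derivative (\<lambda>h. gradf y \<bullet> h)) (at y)"
    and bound: "\<And>w. norm (w - a) < d \<Longrightarrow> norm (gradf w) \<le> C * norm (w - a)"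
    and "norm h < d"
  shows "f (a + h) - f a \<le> C / 2 * (norm h)\<^sup>2"
proof -
  define \<phi> where "\<phi> t = f (a + t *\<^sub>R h) - C / 2 * t\<^sup>2 * (norm h)\<^sup>2" for t
  define \<phi>' where "\<phi>' t = gradf (a + t *\<^sub>R h) \<bullet> h - C * t * (norm h)\<^sup>2" for t
  have "(\<phi> has_real_derivative \<phi>' t) (at t)" for t
  proof -
    have "((\<lambda>t. a + t *\<^sub>R h) has_derivative (\<lambda>s. s *\<^sub>R h)) (at t)"
      by (auto intro!: derivative_eq_intros)
    from has_derivative_compose[OF this grad]
    have "((\<lambda>t. f (a + t *\<^sub>R h)) has_derivative (\<lambda>s. gradf (a + t *\<^sub>R h) \<bullet> (s *\<^sub>R h))) (at t)"
      by (simp add: o_def)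
    then have "((\<lambda>t. f (a + t *\<^sub>R h)) has_real_derivative gradf (a + t *\<^sub>R h) \<bullet> h) (at t)"
      by (simp add: has_field_derivative_def mult_commute_abs)
    then show ?thesis unfolding \<phi>_def \<phi>'_def by (auto intro!: derivative_eq_intros)
  qed
  then obtain z where z: "0 < z" "z < 1" "\<phi> 1 - \<phi> 0 = \<phi>' z"
    using MVT2[of 0 1 \<phi> \<phi>'] by auto
  have "norm (z *\<^sub>R h) < d"
    using z \<open>norm h < d\<close> mult_left_le_one_le[of "norm h" z] by simp
  then have "norm (gradf (a + z *\<^sub>R h)) \<le> C * (z * norm h)"
    using bound[of "a + z *\<^sub>R h"] z by simp
  then have "gradf (a + z *\<^sub>R h) \<bullet> h \<le> C * (z * norm h) * norm h"
    using norm_cauchy_schwarz[of "gradf (a + z *\<^sub>R h)" h] mult_right_mono[of _ _ "norm h"]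
    by (meson norm_ge_zero order_trans)
  then have "\<phi>' z \<le> 0" unfolding \<phi>'_def by (simp add: power2_eq_square algebra_simps)
  with z show ?thesis unfolding \<phi>_def by simp
qed

lemma eventually_le_quadratic_of_gradient_bound:
  fixes f :: "'a::real_inner \<Rightarrow> real"
  assumes "\<And>y. (f has_derivative (\<lambda>h. gradf y \<bullet> h)) (at y)"
    and "\<forall>\<^sub>F w in nhds a. norm (gradf w) \<le> C * norm (w - a)"
  shows "\<forall>\<^sub>F w in nhds a. f w - f a \<le> C / 2 * (norm (w - a))\<^sup>2"
proof -
  obtain d where "0 < d" and bound: "\<And>w. norm (w - a) < d \<Longrightarrow> norm (gradf w) \<le> C * norm (w - a)"
    using assms(2) unfolding eventually_nhds_metric dist_norm by blast
  have "f w - f a \<le> C / 2 * (norm (w - a))\<^sup>2" if "norm (w - a) < d" for w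
    using le_quadratic_of_gradient_bound[OF assms(1) bound that] by simp
  with \<open>0 < d\<close> show ?thesis unfolding eventually_nhds_metric dist_norm by blast
qed

lemma decrease_le_gap_of_tendsto:
  fixes s c :: "nat \<Rightarrow> real"
  assumes decrease: "\<And>n. s (Suc n) + c n \<le> s n" and "\<And>n. 0 \<le> c n" and "s \<longlonglongrightarrow> L"
  shows "c n \<le> s n - L"
proof -
  have "decseq s" using decrease \<open>\<And>n. 0 \<le> c n\<close>
    by (intro decseq_SucI) (smt (verit))
  then have "L \<le> s (Suc n)" using \<open>s \<longlonglongrightarrow> L\<close> by (rule decseq_ge)
  with decrease[of n] show ?thesis by simp
qed

lemma nondegenerate_critical_point_bounds:
  fixes f :: "'a::real_inner \<Rightarrow> real"
  assumes grad: "\<And>y. (f has_derivative (\<lambda>h. gradf y \<bullet> h)) (at y)"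
    and hess: "(gradf has_derivative L) (at a)" and crit: "gradf a = 0"
    and "bounded_linear M" and "\<And>v. M (L v) = v" and "0 < e"
  shows "\<forall>\<^sub>F w in nhds a. f w - f a \<le> (onorm L + e) / 2 * (norm (w - a))\<^sup>2
                        \<and> norm (w - a) \<le> (onorm M + e) * norm (gradf w)"
  using eventually_le_quadratic_of_gradient_bound[OF grad
          eventually_norm_le_onorm_derivative[OF hess crit \<open>0 < e\<close>]]
        eventually_norm_le_onorm_inverse_derivative[OF hess crit assms(6,4,5)]
  by (rule eventually_conj)

lemma armijo_step_size_le:
  fixes c g r A B :: real
  assumes "c * g\<^sup>2 \<le> D" and "D \<le> A / 2 * r\<^sup>2" and "r \<le> B * g"
    and "0 \<le> r" and "0 < g" and "0 \<le> A"
  shows "c \<le> 1/2 * A * B\<^sup>2"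
proof -
  have "A / 2 * r\<^sup>2 \<le> A / 2 * (B * g)\<^sup>2"
    using assms(3-6) by (intro mult_left_mono power_mono) auto
  with assms(1,2) have "c * g\<^sup>2 \<le> (1/2 * A * B\<^sup>2) * g\<^sup>2"
    by (simp add: power_mult_distrib)
  with \<open>0 < g\<close> show ?thesis by simp
qed

theorem theorem1:
  fixes f :: "real^'k \<Rightarrow> real"
    and gradf :: "real^'k \<Rightarrow> real^'k"
    and hessf :: "real^'k \<Rightarrow> real^'k^'k"
    and \<alpha> :: real
    and x :: "nat \<Rightarrow> real^'k"
    and \<delta> :: "nat \<Rightarrow> real"
    and x_inf :: "real^'k"
    and U :: "(real^'k) set"
  assumes grad: "\<And>y. (f has_derivative (\<lambda>h. gradf y \<bullet> h)) (at y)"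
    and grad_cont: "continuous_on UNIV gradf"
    and alpha: "0 < \<alpha>" "\<alpha> < 1"
    and delta_pos: "\<And>n. 0 < \<delta> n"
    and step: "\<And>n. x (Suc n) = x n - \<delta> n *\<^sub>R gradf (x n)"
    and armijo: "\<And>n. f (x n - \<delta> n *\<^sub>R gradf (x n)) - f (x n)
                        \<le> - \<alpha> * \<delta> n * (norm (gradf (x n)))\<^sup>2"
    and grad_nz: "\<And>n. gradf (x n) \<noteq> 0"
    and conv: "x \<longlonglongrightarrow> x_inf"
    and crit: "gradf x_inf = 0"
    and U_open: "open U" and U_mem: "x_inf \<in> U"
    and hess: "\<And>y. y \<in> U \<Longrightarrow> (gradf has_derivative (\<lambda>h. hessf y *v h)) (at y)"
    and hess_cont: "continuous_on U hessf"
    and nondeg: "invertible (hessf x_inf)"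
  shows "\<forall>\<epsilon>>0. \<exists>N. \<forall>n\<ge>N. \<alpha> * \<delta> n \<le>
           1/2 * (onorm (\<lambda>v. hessf x_inf *v v) + \<epsilon>)
               * (onorm (\<lambda>v. matrix_inv (hessf x_inf) *v v) + \<epsilon>)\<^sup>2"
proof (intro allI impI)
  fix \<epsilon> :: real assume "0 < \<epsilon>"
  let ?H = "hessf x_inf"
  have "0 \<le> onorm ((*v) ?H) + \<epsilon>"
    using onorm_pos_le[OF matrix_vector_mul_bounded_linear, of ?H] \<open>0 < \<epsilon>\<close> by simp
  have "(\<lambda>n. f (x n)) \<longlonglongrightarrow> f x_inf"
    using isCont_tendsto_compose[OF has_derivative_continuous[OF grad] conv] .
  moreover have "f (x (Suc n)) + \<alpha> * \<delta> n * (norm (gradf (x n)))\<^sup>2 \<le> f (x n)"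
    and "0 \<le> \<alpha> * \<delta> n * (norm (gradf (x n)))\<^sup>2" for n
    using armijo[of n] step[of n] alpha(1) delta_pos[of n] by simp_all
  ultimately have gap: "\<alpha> * \<delta> n * (norm (gradf (x n)))\<^sup>2 \<le> f (x n) - f x_inf" for n
    by (intro decrease_le_gap_of_tendsto[where s = "\<lambda>n. f (x n)"])
  have "\<forall>\<^sub>F w in nhds x_inf. f w - f x_inf \<le> (onorm ((*v) ?H) + \<epsilon>) / 2 * (norm (w - x_inf))\<^sup>2
          \<and> norm (w - x_inf) \<le> (onorm ((*v) (matrix_inv ?H)) + \<epsilon>) * norm (gradf w)"
    using nondegenerate_critical_point_bounds[OF grad hess[OF U_mem] crit _ _ \<open>0 < \<epsilon>\<close>]
    by (simp add: matrix_inv_mult_vec_cancel[OF nondeg])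
  from eventually_compose_filterlim[OF this conv]
  have "\<forall>\<^sub>F n in sequentially. \<alpha> * \<delta> n \<le>
          1/2 * (onorm ((*v) ?H) + \<epsilon>) * (onorm ((*v) (matrix_inv ?H)) + \<epsilon>)\<^sup>2"
  proof eventually_elim
    case (elim n)
    then show ?case
      using grad_nz[of n] \<open>0 \<le> onorm ((*v) ?H) + \<epsilon>\<close>
      by (intro armijo_step_size_le[where r = "norm (x n - x_inf)", OF gap[of n]]) auto
  qed
  then show "\<exists>N. \<forall>n\<ge>N. \<alpha> * \<delta> n \<le>
      1/2 * (onorm (\<lambda>v. ?H *v v) + \<epsilon>) * (onorm (\<lambda>v. matrix_inv ?H *v v) + \<epsilon>)\<^sup>2"
    unfolding eventually_sequentially by simp
qed

end
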